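(* For any graph $G$ with order $n\geq 3$, $$\mathrm{gp}(\mathcal{M}(G))\geq \max\{n,\,2\,\mathrm{ip}_4(G)\}.$$
   Context: All graphs are simple, connected and finite. A set $S$ of vertices of a graph $H$ is a general position set if no shortest path in $H$ contains three or more vertices of $S$; $\mathrm{gp}(H)$ is the number of vertices in a largest general position set of $H$. The Mycielskian $\mathcal{M}(G)$ of a graph $G$ with vertex set $V$ and edge set $E$ has vertex set $V\cup V'\cup\{u^*\}$, where $V'=\{u' : u\in V\}$ is a disjoint copy of $V$ and $u^*$ is an additional vertex (the root), and edge set $E\cup\{uv' : uv\in E\}\cup\{v'u^* : v'\in V'\}$ (for each edge $uv\in E$ both $uv'$ and $vu'$ are included). An independent $d$-position set of $G$ is a subset $S\subseteq V(G)$ that is an independent set and such that no shortest path of $G$ of length at most $d$ passes through three or more vertices of $S$; $\mathrm{ip}_d(G)$ is the largest number of vertices in an independent $d$-position set of $G$. *)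

theory Defs
  imports "Graph_Theory.Graph_Theory"
begin

text \<open>
  Simple finite graphs are rendered by \<^locale>\<open>pair_graph\<close>: finite, loop-free, and with a
  symmetric arc relation, so that an edge \<open>uv\<close> is the pair of arcs \<open>(u, v)\<close>, \<open>(v, u)\<close>.
\<close>

definition shortest_path :: "'a pair_pre_digraph \<Rightarrow> 'a vwalk \<Rightarrow> bool" where
  "shortest_path G p \<longleftrightarrow> vpath p G \<and>
     (\<forall>q. vpath q G \<and> hd q = hd p \<and> last q = last p \<longrightarrow> vwalk_length p \<le> vwalk_length q)"

definition general_position_set :: "'a pair_pre_digraph \<Rightarrow> 'a set \<Rightarrow> bool" where
  "general_position_set G S \<longleftrightarrow> S \<subseteq> pverts G \<and>
     \<not> (\<exists>p. shortest_path G p \<and> card (set p \<inter> S) \<ge> 3)"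

definition gp :: "'a pair_pre_digraph \<Rightarrow> nat" where
  "gp G = Max (card ` {S. general_position_set G S})"

definition independent_set :: "'a pair_pre_digraph \<Rightarrow> 'a set \<Rightarrow> bool" where
  "independent_set G S \<longleftrightarrow> S \<subseteq> pverts G \<and> (\<forall>u\<in>S. \<forall>v\<in>S. (u, v) \<notin> parcs G)"

definition independent_position_set :: "nat \<Rightarrow> 'a pair_pre_digraph \<Rightarrow> 'a set \<Rightarrow> bool" where
  "independent_position_set d G S \<longleftrightarrow> independent_set G S \<and>
     \<not> (\<exists>p. shortest_path G p \<and> vwalk_length p \<le> d \<and> card (set p \<inter> S) \<ge> 3)"

definition ip :: "nat \<Rightarrow> 'a pair_pre_digraph \<Rightarrow> nat" where
  "ip d G = Max (card ` {S. independent_position_set d G S})"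

datatype 'a mycielskian_vertex = Orig 'a | Copy 'a | Root

definition mycielskian :: "'a pair_pre_digraph \<Rightarrow> 'a mycielskian_vertex pair_pre_digraph" where
  "mycielskian G =
    \<lparr> pverts = Orig ` pverts G \<union> Copy ` pverts G \<union> {Root},
      parcs = {(Orig u, Orig v) | u v. (u, v) \<in> parcs G}
            \<union> {(Orig u, Copy v) | u v. (u, v) \<in> parcs G}
            \<union> {(Copy u, Orig v) | u v. (u, v) \<in> parcs G}
            \<union> {(Copy v, Root) | v. v \<in> pverts G}
            \<union> {(Root, Copy v) | v. v \<in> pverts G} \<rparr>"

lemma pair_graph_mycielskian:
  assumes "pair_graph G"
  shows "pair_graph (mycielskian G)"
proof -
  interpret pair_graph G by fact
  let ?M = "mycielskian G"
  have wf: "fst e \<in> pverts ?M \<and> snd e \<in> pverts ?M" if "e \<in> parcs ?M" for e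
    using that by (auto simp: mycielskian_def dest: in_arcsD1 in_arcsD2)
  have fin: "finite (pverts ?M)"
    using pair_finite_verts by (simp add: mycielskian_def)
  have "parcs ?M \<subseteq> pverts ?M \<times> pverts ?M"
    using wf by force
  then have finA: "finite (parcs ?M)"
    using fin by (meson finite_SigmaI finite_subset)
  have "sym (parcs ?M)"
    by (rule symI) (auto simp: mycielskian_def dest: arcs_symmetric)
  then have sy: "symmetric (with_proj ?M)"
    by (simp add: symmetric_def)
  have nl: "fst e \<noteq> snd e" if "e \<in> parcs ?M" for e
    using that by (auto simp: mycielskian_def dest: no_loops')
  show ?thesis
    by unfold_locales (use wf fin finA sy nl in auto)
qed

text \<open>The maxima in \<^const>\<open>gp\<close> and \<^const>\<open>ip\<close> range over finite nonempty sets.\<close>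

lemma gp_attained:
  assumes "finite (pverts G)"
  shows "\<exists>S. general_position_set G S \<and> card S = gp G"
    and "general_position_set G S \<Longrightarrow> card S \<le> gp G"
proof -
  have fin: "finite (card ` {S. general_position_set G S})"
    by (rule finite_imageI, rule finite_subset[of _ "Pow (pverts G)"])
       (use assms in \<open>auto simp: general_position_set_def\<close>)
  have "general_position_set G {}"
    by (simp add: general_position_set_def)
  then have "card ` {S. general_position_set G S} \<noteq> {}"
    by blast
  from Max_in[OF fin this] show "\<exists>S. general_position_set G S \<and> card S = gp G"
    by (auto simp: gp_def)
  show "card S \<le> gp G" if "general_position_set G S"
    unfolding gp_def by (rule Max_ge[OF fin]) (use that in auto)
qed

lemma ip_attained:
  assumes "finite (pverts G)"
  shows "\<exists>S. independent_position_set d G S \<and> card S = ip d G"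
    and "independent_position_set d G S \<Longrightarrow> card S \<le> ip d G"
proof -
  have fin: "finite (card ` {S. independent_position_set d G S})"
    by (rule finite_imageI, rule finite_subset[of _ "Pow (pverts G)"])
       (use assms in \<open>auto simp: independent_position_set_def independent_set_def\<close>)
  have "independent_position_set d G {}"
    by (simp add: independent_position_set_def independent_set_def)
  then have "card ` {S. independent_position_set d G S} \<noteq> {}"
    by blast
  from Max_in[OF fin this] show "\<exists>S. independent_position_set d G S \<and> card S = ip d G"
    by (auto simp: ip_def)
  show "card S \<le> ip d G" if "independent_position_set d G S"
    unfolding ip_def by (rule Max_ge[OF fin]) (use that in auto)
qed

end

theory Submission
  imports Defs
begin

text \<open>
  Two sets in general position give the two bounds. Both rest on one observation
  (\<open>independent_set_not_general_position\<close>): an independent set that fails to be in general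
  position contains the two ends of a shortest path of length at least four, with a third
  member strictly inside.

  The copies form an independent set, and any two of them are joined through the root by a walk
  of length two; hence they are in general position, which gives \<open>n\<close>.

  For an independent \<open>4\<close>-position set \<open>S\<close> of \<open>G\<close>, the originals and the copies of the members
  of \<open>S\<close> together form an independent set. Every vertex of \<open>G\<close> has a neighbour, so walks
  through the root join any two non-root vertices within four steps, and within three
  unless both are originals (\<open>mycielskian_short_walk\<close>). A violating shortest path
  therefore has length exactly four and runs between two originals. It does not meet the
  root, so it projects to a walk of length four in \<open>G\<close>. No walk of \<open>G\<close> between the same ends is
  shorter, since \<open>G\<close> embeds in the Mycielskian; hence the projection is a shortest path of \<open>G\<close>
  of length four whose first, middle and last vertices lie in \<open>S\<close>, which is impossible
  (\<open>general_position_double\<close>). Its vertices being distinct also rules out that the middle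
  vertex is the copy of one of the ends.
\<close>

section \<open>Shortest paths among walks\<close>

lemma vwalk_pair_iff_successively:
  assumes "pair_wf_digraph G"
  shows "vwalk p G \<longleftrightarrow>
    p \<noteq> [] \<and> set p \<subseteq> pverts G \<and> successively (\<lambda>x y. (x, y) \<in> parcs G) p"
proof -
  interpret pair_wf_digraph G by fact
  have "set (vwalk_arcs p) \<subseteq> parcs G \<longleftrightarrow> successively (\<lambda>x y. (x, y) \<in> parcs G) p"
    by (induction p rule: vwalk_arcs.induct) auto
  moreover have "arcs_ends G = parcs G"
    by (auto simp: arcs_ends_def arc_to_ends_def)
  ultimately show ?thesis
    by (auto simp: vwalk_def)
qed

lemma length_vwalk_to_vpath_le: "length (vwalk_to_vpath p) \<le> length p"
proof (induction p rule: vwalk_to_vpath.induct)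
  case (2 x xs)
  then show ?case
    using length_dropWhile_le[of "\<lambda>y. y \<noteq> x" xs] by auto
qed simp

lemma length_vwalk_to_vpath_less:
  "\<not> distinct p \<Longrightarrow> length (vwalk_to_vpath p) < length p"
proof (induction p rule: vwalk_to_vpath.induct)
  case (2 x xs)
  then show ?case
    using length_dropWhile_le[of "\<lambda>y. y \<noteq> x" xs]
      length_vwalk_to_vpath_le[of "dropWhile (\<lambda>y. y \<noteq> x) xs"]
    by auto
qed simp

text \<open>
  Cutting out the closed detours of a walk only shortens it, so it does not matter whether
  competitors are paths or arbitrary walks; a walk of minimal length has no detours and is a path.
\<close>

lemma shortest_path_iff_minimal_vwalk:
  "shortest_path G p \<longleftrightarrow> vwalk p G \<and>
     (\<forall>q. vwalk q G \<and> hd q = hd p \<and> last q = last p \<longrightarrow> length p \<le> length q)"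
    (is "_ \<longleftrightarrow> ?R")
proof
  assume sp: "shortest_path G p"
  have "length p \<le> length q" if q: "vwalk q G" "hd q = hd p" "last q = last p" for q
  proof -
    let ?q = "vwalk_to_vpath q"
    have "vwalk_length p \<le> vwalk_length ?q"
      using sp q unfolding shortest_path_def
      by (metis vwalk_to_vpath_hd vwalk_to_vpath_last vwalk_to_vpath_vpath)
    moreover have "?q \<noteq> []"
      using q(1) by (simp add: vwalk_def vwalk_to_vpath_nonempty)
    ultimately have "length p \<le> length ?q"
      by (cases "?q") auto
    then show ?thesis
      using length_vwalk_to_vpath_le[of q] by linarith
  qed
  moreover have "vwalk p G"
    using sp by (simp add: shortest_path_def vpath_def)
  ultimately show ?R
    by blast
next
  assume R: ?R
  have "distinct p"
  proof (rule ccontr)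
    assume "\<not> distinct p"
    then have "length (vwalk_to_vpath p) < length p"
      by (rule length_vwalk_to_vpath_less)
    moreover have "length p \<le> length (vwalk_to_vpath p)"
      using R vwalk_to_vpath_vpath[of p G]
      by (simp add: vpath_def vwalk_to_vpath_hd vwalk_to_vpath_last)
    ultimately show False by simp
  qed
  then show "shortest_path G p"
    using R by (simp add: shortest_path_def vpath_def diff_le_mono)
qed

lemma shortest_path_imp_vwalk: "shortest_path G p \<Longrightarrow> vwalk p G"
  by (simp add: shortest_path_iff_minimal_vwalk)

lemma shortest_path_length_le:
  assumes "shortest_path G p" and "vwalk q G" and "hd q = hd p" and "last q = last p"
  shows "length p \<le> length q"
  using assms by (simp add: shortest_path_iff_minimal_vwalk)

text \<open>A shorter connection between the ends of an infix could be spliced into the whole path.\<close>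

lemma shortest_path_infix:
  assumes G: "pair_wf_digraph G" and sp: "shortest_path G (p1 @ p @ p2)" and ne: "p \<noteq> []"
  shows "shortest_path G p"
proof -
  note w = shortest_path_imp_vwalk[OF sp]
  have "length p \<le> length q" if q: "vwalk q G" "hd q = hd p" "last q = last p" for q
  proof -
    have "q \<noteq> []"
      using q(1) by (simp add: vwalk_def)
    then have "vwalk (p1 @ q @ p2) G"
      using w q ne by (auto simp: vwalk_pair_iff_successively[OF G] successively_append_iff)
    moreover have "hd (p1 @ q @ p2) = hd (p1 @ p @ p2)"
      using ne \<open>q \<noteq> []\<close> q by (simp add: hd_append)
    moreover have "last (p1 @ q @ p2) = last (p1 @ p @ p2)"
      using ne \<open>q \<noteq> []\<close> q by (simp add: last_append)
    ultimately have "length (p1 @ p @ p2) \<le> length (p1 @ q @ p2)"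
      by (rule shortest_path_length_le[OF sp])
    then show ?thesis by simp
  qed
  moreover have "vwalk p G"
    using w ne by (auto simp: vwalk_pair_iff_successively[OF G] successively_append_iff)
  ultimately show ?thesis
    by (simp add: shortest_path_iff_minimal_vwalk)
qed

section \<open>Independent sets that are not in general position\<close>

lemma list_meets_set_thrice:
  assumes "card (set p \<inter> T) \<ge> 3"
  shows "\<exists>as x bs y cs z ds. p = as @ x # bs @ y # cs @ z # ds \<and> {x, y, z} \<subseteq> T"
proof -
  have "set p \<inter> T = set (filter (\<lambda>v. v \<in> T) p)"
    by auto
  then have "length (filter (\<lambda>v. v \<in> T) p) \<ge> 3"
    using assms card_length[of "filter (\<lambda>v. v \<in> T) p"] by simp
  then obtain x y z zs where "filter (\<lambda>v. v \<in> T) p = x # y # z # zs"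
    by (auto simp: numeral_3_eq_3 Suc_le_length_iff)
  then obtain as q where q: "p = as @ x # q" "x \<in> T" "filter (\<lambda>v. v \<in> T) q = y # z # zs"
    by (auto dest!: filter_eq_ConsD)
  then obtain bs r where r: "q = bs @ y # r" "y \<in> T" "filter (\<lambda>v. v \<in> T) r = z # zs"
    by (auto dest!: filter_eq_ConsD)
  then obtain cs ds where "r = cs @ z # ds" "z \<in> T"
    by (auto dest!: filter_eq_ConsD)
  with q r show ?thesis
    by blast
qed

text \<open>
  Consecutive vertices of a path are adjacent, so a path meeting an independent set skips at least
  one vertex between two visits. Restricting to the stretch between the first and the third visit
  gives a shortest path of length at least four with both ends in the set.
\<close>

lemma independent_set_not_general_position:
  assumes G: "pair_wf_digraph G" and ind: "independent_set G T"
    and no: "\<not> general_position_set G T"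
  obtains x bs y cs z where "shortest_path G (x # bs @ y # cs @ [z])"
    and "bs \<noteq> []" and "cs \<noteq> []" and "x \<in> T" and "y \<in> T" and "z \<in> T"
proof -
  obtain p where p: "shortest_path G p" "card (set p \<inter> T) \<ge> 3"
    using no ind by (auto simp: general_position_set_def independent_set_def)
  obtain as x bs y cs z ds where split: "p = as @ x # bs @ y # cs @ z # ds" "{x, y, z} \<subseteq> T"
    using list_meets_set_thrice[OF p(2)] by blast
  let ?q = "x # bs @ y # cs @ [z]"
  have "shortest_path G ?q"
    by (rule shortest_path_infix[OF G, of as _ ds]) (use p split in simp_all)
  moreover from this have "vwalk ?q G"
    by (rule shortest_path_imp_vwalk)
  then have "bs \<noteq> []" "cs \<noteq> []"
    using ind split by (auto simp: vwalk_pair_iff_successively[OF G] independent_set_def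
        successively_append_iff successively_Cons)
  ultimately show ?thesis
    using that split by blast
qed

section \<open>The Mycielskian\<close>

lemma pverts_mycielskian [simp]:
  "Orig v \<in> pverts (mycielskian G) \<longleftrightarrow> v \<in> pverts G"
  "Copy v \<in> pverts (mycielskian G) \<longleftrightarrow> v \<in> pverts G"
  "Root \<in> pverts (mycielskian G)"
  by (auto simp: mycielskian_def)

lemma parcs_mycielskian [simp]:
  "(Orig u, Orig v) \<in> parcs (mycielskian G) \<longleftrightarrow> (u, v) \<in> parcs G"
  "(Orig u, Copy v) \<in> parcs (mycielskian G) \<longleftrightarrow> (u, v) \<in> parcs G"
  "(Copy u, Orig v) \<in> parcs (mycielskian G) \<longleftrightarrow> (u, v) \<in> parcs G"
  "(Copy u, Copy v) \<notin> parcs (mycielskian G)"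
  "(Copy u, Root) \<in> parcs (mycielskian G) \<longleftrightarrow> u \<in> pverts G"
  "(Root, Copy v) \<in> parcs (mycielskian G) \<longleftrightarrow> v \<in> pverts G"
  "(Orig u, Root) \<notin> parcs (mycielskian G)"
  "(Root, Orig v) \<notin> parcs (mycielskian G)"
  by (auto simp: mycielskian_def)

lemma connected_imp_no_isolated_vertex:
  assumes "pair_graph G" and "connected G" and "card (pverts G) \<ge> 2" and u: "u \<in> pverts G"
  shows "\<exists>v. (u, v) \<in> parcs G"
proof -
  interpret pair_graph G by fact
  have "\<not> pverts G \<subseteq> {u}"
    using assms(3) card_mono[of "{u}" "pverts G"] by auto
  then obtain w where w: "w \<in> pverts G" "w \<noteq> u"
    by blast
  have "strongly_connected G"
    using assms(2) by (rule symmetric_connected_imp_strongly_connected[OF sym_arcs])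
  then obtain p where p: "vwalk p G" "hd p = u" "last p = w"
    using u w by (auto simp: strongly_connected_def reachable_vwalk_conv)
  obtain v q where "p = u # v # q"
    using p w by (cases p; cases "tl p") auto
  then show ?thesis
    using p vwalk_pair_iff_successively[OF pair_wf_digraph_axioms, of p] by auto
qed

text \<open>
  A violation would need two copies at distance at least four, but the root is adjacent to all
  copies.
\<close>

lemma general_position_copies:
  assumes G: "pair_graph G"
  shows "general_position_set (mycielskian G) (Copy ` pverts G)"
proof (rule ccontr)
  let ?M = "mycielskian G"
  interpret M: pair_graph ?M
    by (rule pair_graph_mycielskian[OF G])
  note walk = vwalk_pair_iff_successively[OF M.pair_wf_digraph_axioms]
  have ind: "independent_set ?M (Copy ` pverts G)"
    by (auto simp: independent_set_def)
  assume "\<not> general_position_set ?M (Copy ` pverts G)"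
  then obtain x bs y cs z where p: "shortest_path ?M (x # bs @ y # cs @ [z])"
    and ne: "bs \<noteq> []" "cs \<noteq> []" and xz: "x \<in> Copy ` pverts G" "z \<in> Copy ` pverts G"
    by (rule independent_set_not_general_position[OF M.pair_wf_digraph_axioms ind])
  have "vwalk [x, Root, z] ?M"
    using xz unfolding walk by auto
  then have "length (x # bs @ y # cs @ [z]) \<le> length [x, Root, z]"
    by (rule shortest_path_length_le[OF p]) simp_all
  moreover have "length bs > 0" "length cs > 0"
    using ne by auto
  ultimately show False
    by simp
qed

text \<open>
  The projection of the Mycielskian onto the graph it is built from. The root lies over no vertex;
  its value is arbitrary.
\<close>

fun base_vertex :: "'a mycielskian_vertex \<Rightarrow> 'a" where
  "base_vertex (Orig v) = v"
| "base_vertex (Copy v) = v"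
| "base_vertex Root = undefined"

lemma parcs_base_vertex:
  assumes "(x, y) \<in> parcs (mycielskian G)" and "x \<noteq> Root" and "y \<noteq> Root"
  shows "(base_vertex x, base_vertex y) \<in> parcs G"
  using assms by (cases x; cases y) simp_all

lemma vwalk_map_Orig:
  assumes G: "pair_graph G" and w: "vwalk p G"
  shows "vwalk (map Orig p) (mycielskian G)"
proof -
  interpret pair_graph G by fact
  interpret M: pair_graph "mycielskian G"
    by (rule pair_graph_mycielskian[OF G])
  show ?thesis
    using w unfolding vwalk_pair_iff_successively[OF pair_wf_digraph_axioms]
      vwalk_pair_iff_successively[OF M.pair_wf_digraph_axioms]
    by (auto simp: successively_map)
qed

text \<open>
  Go to the root and back: a copy is adjacent to the root, and an original reaches it in
  two steps through the copy of one of its neighbours.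
\<close>

lemma mycielskian_short_walk:
  assumes G: "pair_graph G" and nbr: "\<And>u. u \<in> pverts G \<Longrightarrow> \<exists>v. (u, v) \<in> parcs G"
    and x: "x \<in> pverts (mycielskian G)" "x \<noteq> Root" and z: "z \<in> pverts (mycielskian G)" "z \<noteq> Root"
  obtains q where "vwalk q (mycielskian G)" "hd q = x" "last q = z" "length q \<le> 5"
    and "\<not> (\<exists>u w. x = Orig u \<and> z = Orig w) \<Longrightarrow> length q \<le> 4"
proof -
  interpret pair_graph G by fact
  interpret M: pair_graph "mycielskian G"
    by (rule pair_graph_mycielskian[OF G])
  note walk = vwalk_pair_iff_successively[OF M.pair_wf_digraph_axioms]
  let ?u = "base_vertex x" and ?w = "base_vertex z"
  have uw: "?u \<in> pverts G" "?w \<in> pverts G"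
    using x z by (cases x; cases z; simp)+
  obtain a where a: "(?u, a) \<in> parcs G"
    using nbr uw by blast
  obtain b where b: "(b, ?w) \<in> parcs G"
    using nbr uw arcs_symmetric by blast
  have ab: "a \<in> pverts G" "b \<in> pverts G"
    using a b by (auto dest: in_arcsD1 in_arcsD2)
  define l where "l = (case x of Orig u \<Rightarrow> [x, Copy a] | _ \<Rightarrow> [x])"
  define r where "r = (case z of Orig w \<Rightarrow> [Copy b, z] | _ \<Rightarrow> [z])"
  have "vwalk (l @ Root # r) (mycielskian G)"
    using x z uw a b ab unfolding walk l_def r_def
    by (cases x; cases z) simp_all
  then show ?thesis
    by (rule that) (use x z in \<open>cases x; cases z; simp add: l_def r_def\<close>)+
qed

text \<open>
  The bound four on the length of the forbidden paths suffices because distances between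
  non-root vertices of the Mycielskian never exceed four. A violation must realise this
  maximum, and then it avoids the root and is visible in \<open>G\<close> itself.
\<close>

lemma general_position_double:
  assumes G: "pair_graph G" and nbr: "\<And>u. u \<in> pverts G \<Longrightarrow> \<exists>v. (u, v) \<in> parcs G"
    and S: "independent_position_set 4 G S"
  shows "general_position_set (mycielskian G) (Orig ` S \<union> Copy ` S)"
proof (rule ccontr)
  let ?M = "mycielskian G" and ?T = "Orig ` S \<union> Copy ` S"
  interpret pair_graph G by fact
  interpret M: pair_graph ?M
    by (rule pair_graph_mycielskian[OF G])
  note Gwalk = vwalk_pair_iff_successively[OF pair_wf_digraph_axioms]
  note Mwalk = vwalk_pair_iff_successively[OF M.pair_wf_digraph_axioms]
  have SV: "S \<subseteq> pverts G"
    using S by (simp add: independent_position_set_def independent_set_def)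
  have ind: "independent_set ?M ?T"
    using S by (auto simp: independent_position_set_def independent_set_def)
  assume "\<not> general_position_set ?M ?T"
  then obtain x bs y cs z where p: "shortest_path ?M (x # bs @ y # cs @ [z])"
    and ne: "bs \<noteq> []" "cs \<noteq> []" and xyz: "x \<in> ?T" "y \<in> ?T" "z \<in> ?T"
    by (rule independent_set_not_general_position[OF M.pair_wf_digraph_axioms ind])
  let ?p = "x # bs @ y # cs @ [z]"
  have minimal: "length ?p \<le> length q" if "vwalk q ?M" "hd q = x" "last q = z" for q
    using shortest_path_length_le[OF p that(1)] that(2,3) by simp
  \<comment> \<open>Lists of vertices are one longer than the walks: five vertices mean length four.\<close>
  have ge5: "length ?p \<ge> 5"
    using ne by (cases bs; cases cs) auto
  have "x \<in> pverts ?M" "x \<noteq> Root" "z \<in> pverts ?M" "z \<noteq> Root" "y \<noteq> Root"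
    using xyz ind by (auto simp: independent_set_def)
  then obtain q where q: "vwalk q ?M" "hd q = x" "last q = z" "length q \<le> 5"
    and q4: "\<not> (\<exists>u w. x = Orig u \<and> z = Orig w) \<Longrightarrow> length q \<le> 4"
    using mycielskian_short_walk[OF G nbr] by metis
  have "length q \<ge> 5" "length ?p \<le> 5"
    using minimal[OF q(1-3)] ge5 q(4) by linarith+
  then obtain u w where uw: "x = Orig u" "z = Orig w"
    using q4 by fastforce
  obtain a b where ab: "bs = [a]" "cs = [b]"
    using \<open>length ?p \<le> 5\<close> ne by (cases bs; cases cs) auto
  have arcs: "(x, a) \<in> parcs ?M" "(a, y) \<in> parcs ?M" "(y, b) \<in> parcs ?M" "(b, z) \<in> parcs ?M"
    using shortest_path_imp_vwalk[OF p] ab by (simp_all add: Mwalk)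
  \<comment> \<open>Originals are not adjacent to the root, and \<open>y\<close> lies over \<open>S\<close>: the path projects to \<open>G\<close>.\<close>
  have "a \<noteq> Root" "b \<noteq> Root"
    using arcs uw by auto
  define v where "v = base_vertex y"
  let ?g = "[u, base_vertex a, v, base_vertex b, w]"
  have "successively (\<lambda>x y. (x, y) \<in> parcs G) ?g"
    using arcs[THEN parcs_base_vertex] uw \<open>a \<noteq> Root\<close> \<open>b \<noteq> Root\<close> \<open>y \<noteq> Root\<close> by (simp add: v_def)
  then have "vwalk ?g G"
    by (auto simp: Gwalk dest: in_arcsD1 in_arcsD2)
  \<comment> \<open>A shorter walk of \<open>G\<close> would lift to originals and beat \<open>?p\<close>, whose ends are originals.\<close>
  moreover have "length ?g \<le> length r" if r: "vwalk r G" "hd r = u" "last r = w" for r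
  proof -
    have "r \<noteq> []"
      using r(1) by (simp add: vwalk_def)
    then have "length ?p \<le> length (map Orig r)"
      using r uw by (intro minimal vwalk_map_Orig[OF G]) (auto simp: hd_map last_map)
    then show ?thesis
      using ge5 by simp
  qed
  ultimately have g: "shortest_path G ?g"
    by (simp add: shortest_path_iff_minimal_vwalk)
  then have "distinct ?g"
    by (simp add: shortest_path_def vpath_def)
  moreover have "{u, v, w} \<subseteq> S"
    using xyz uw by (auto simp: v_def)
  ultimately have "card {u, v, w} = 3" "{u, v, w} \<subseteq> set ?g \<inter> S"
    by auto
  then have "card (set ?g \<inter> S) \<ge> 3"
    by (metis List.finite_set card_mono finite_Int)
  moreover have "vwalk_length ?g \<le> 4"
    by simp
  ultimately show False
    using S g unfolding independent_position_set_def by blast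
qed

theorem corollary11:
  fixes G :: "'a pair_pre_digraph" and n :: nat
  assumes "pair_graph G"
    and "connected G"
    and "card (pverts G) = n"
    and "n \<ge> 3"
  shows "gp (mycielskian G) \<ge> max n (2 * ip 4 G)"
proof -
  interpret pair_graph G by fact
  interpret M: pair_graph "mycielskian G"
    using assms(1) by (rule pair_graph_mycielskian)
  note gp_ge = gp_attained(2)[OF M.pair_finite_verts]
  have "card (Copy ` pverts G) = n"
    using assms(3) by (simp add: card_image inj_on_def)
  then have "n \<le> gp (mycielskian G)"
    using gp_ge[OF general_position_copies[OF assms(1)]] by simp
  moreover have "2 * ip 4 G \<le> gp (mycielskian G)"
  proof -
    obtain S where S: "independent_position_set 4 G S" "card S = ip 4 G"
      using ip_attained(1)[OF pair_finite_verts] by blast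
    have "finite S"
      using S(1) pair_finite_verts
      by (auto simp: independent_position_set_def independent_set_def intro: finite_subset)
    then have "card (Orig ` S \<union> Copy ` S) = card (Orig ` S) + card (Copy ` S)"
      by (intro card_Un_disjoint) auto
    also have "\<dots> = 2 * ip 4 G"
      using S(2) by (simp add: card_image inj_on_def)
    finally show ?thesis
      using gp_ge[OF general_position_double[OF assms(1) _ S(1)]]
        connected_imp_no_isolated_vertex[OF assms(1,2)] assms(3,4) by simp
  qed
  ultimately show ?thesis
    by simp
qed

end
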